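(* Let $\alpha\in\Sigma^\omega$ be disjunctive, and suppose $\alpha(n)$ can be effectively computed given $n$. Then there is an algorithm which, given a deterministic finite Muller automaton $\mathcal{A}$ over $\Sigma$, decides whether $\mathcal{A}$ accepts $\alpha$.
   Context: An infinite word $\alpha$ over a finite alphabet $\Sigma$ is disjunctive if every finite word $u\in\Sigma^*$ occurs infinitely often in $\alpha$. A deterministic finite Muller automaton over $\Sigma$ is $(Q,q_{\mathrm{init}},\delta,\mathcal{F})$ with finite $Q$, $\delta\colon Q\times\Sigma\to Q$, $\mathcal{F}\subseteq 2^Q$; it accepts $\alpha$ iff the set of states occurring infinitely often in its run on $\alpha$ belongs to $\mathcal{F}$. *)

theory Defs
  imports Main "HOL-Library.Nat_Bijection" "HOL-Library.Omega_Words_Fun"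
begin

section \<open>Partial recursive functions\<close>

text \<open>
  Kleene's schemes: initial functions, composition, primitive recursion and unbounded search.
  Arities are implicit: a term denotes a partial function on argument lists of any length, where
  \<open>Zero\<close> and \<open>Proj i\<close> serve as the constant and projection functions of every suitable arity.
\<close>

datatype recf =
    Zero
  | Succ
  | Proj nat
  | Comp recf "recf list"
  | PrimRec recf recf
  | Mu recf

text \<open>
  \<open>evaluates r xs y\<close>: the function described by \<open>r\<close> is defined on the arguments \<open>xs\<close>, with
  value \<open>y\<close>. The recursion (respectively search) variable is the first argument.
\<close>

inductive evaluates :: "recf \<Rightarrow> nat list \<Rightarrow> nat \<Rightarrow> bool" where
  zero: "evaluates Zero xs 0"
| succ: "evaluates Succ [x] (Suc x)"
| proj: "i < length xs \<Longrightarrow> evaluates (Proj i) xs (xs ! i)"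
| comp: "length ys = length gs \<Longrightarrow> (\<And>i. i < length gs \<Longrightarrow> evaluates (gs ! i) xs (ys ! i))
           \<Longrightarrow> evaluates f ys z \<Longrightarrow> evaluates (Comp f gs) xs z"
| primrec_0: "evaluates f xs z \<Longrightarrow> evaluates (PrimRec f g) (0 # xs) z"
| primrec_Suc: "evaluates (PrimRec f g) (n # xs) y \<Longrightarrow> evaluates g (n # y # xs) z
           \<Longrightarrow> evaluates (PrimRec f g) (Suc n # xs) z"
| mu: "evaluates f (n # xs) 0 \<Longrightarrow> (\<And>m. m < n \<Longrightarrow> \<exists>y. evaluates f (m # xs) (Suc y))
           \<Longrightarrow> evaluates (Mu f) xs n"

inductive_cases evaluates_elims:
  "evaluates Zero xs y"
  "evaluates Succ xs y"
  "evaluates (Proj i) xs y"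
  "evaluates (Comp f gs) xs y"
  "evaluates (PrimRec f g) (0 # xs) y"
  "evaluates (PrimRec f g) (Suc n # xs) y"
  "evaluates (Mu f) xs y"

lemma evaluates_deterministic:
  "evaluates r xs y \<Longrightarrow> evaluates r xs y' \<Longrightarrow> y = y'"
proof (induction arbitrary: y' rule: evaluates.induct)
  case (comp ys gs xs f z)
  from comp.prems obtain ys' where ys': "length ys' = length gs"
    "\<And>i. i < length gs \<Longrightarrow> evaluates (gs ! i) xs (ys' ! i)" and z: "evaluates f ys' y'"
    by (rule evaluates_elims(4)) blast
  have "ys = ys'"
    using comp.hyps(1) comp.IH(1) ys' by (intro nth_equalityI) simp_all
  with z comp.IH(2) show ?case by blast
next
  case (primrec_Suc f g n xs y z)
  from primrec_Suc.prems obtain w where "evaluates (PrimRec f g) (n # xs) w"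
    "evaluates g (n # w # xs) y'"
    by (rule evaluates_elims(6)) blast
  with primrec_Suc.IH show ?case by blast
next
  case (mu f n xs)
  from mu.prems have 0: "evaluates f (y' # xs) 0"
    and less: "\<And>m. m < y' \<Longrightarrow> \<exists>y. evaluates f (m # xs) (Suc y)"
    by (auto elim: evaluates_elims(7))
  show ?case
  proof (rule linorder_cases[of n y'])
    assume "n < y'"
    with less mu.IH(1) show ?thesis by blast
  next
    assume "y' < n"
    with 0 mu.IH(2) show ?thesis by blast
  qed
qed (blast elim: evaluates_elims)+

definition computable :: "(nat \<Rightarrow> nat) \<Rightarrow> bool" where
  "computable f \<longleftrightarrow> (\<exists>r. \<forall>n. evaluates r [n] (f n))"

text \<open>
  Decidability of \<open>P\<close> for inputs \<open>x \<in> D\<close> presented by their codes \<open>code x\<close>: one algorithm halts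
  with the correct answer on all of them. Nothing is required on numbers that code no input.
\<close>

definition decidable_on :: "'i set \<Rightarrow> ('i \<Rightarrow> nat) \<Rightarrow> ('i \<Rightarrow> bool) \<Rightarrow> bool" where
  "decidable_on D code P \<longleftrightarrow>
     (\<exists>r. \<forall>x\<in>D. evaluates r [code x] (if P x then 1 else 0))"

section \<open>Disjunctive words\<close>

definition disjunctive :: "'a set \<Rightarrow> 'a word \<Rightarrow> bool" where
  "disjunctive \<Sigma> \<alpha> \<longleftrightarrow>
     (\<forall>u\<in>lists \<Sigma>. \<exists>\<^sub>\<infinity>i. subsequence \<alpha> i (i + length u) = u)"

section \<open>Deterministic Muller automata\<close>

text \<open>
  Automata are inputs of algorithms, so states are taken to be natural numbers; the state set
  may be any finite set of them.
\<close>

record 'a dma =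
  states :: "nat set"
  initial :: nat
  step :: "nat \<Rightarrow> 'a \<Rightarrow> nat"
  accepting :: "nat set set"

definition dma_over :: "'a set \<Rightarrow> 'a dma set" where
  "dma_over \<Sigma> = {A. finite (states A) \<and> initial A \<in> states A \<and>
     (\<forall>q\<in>states A. \<forall>a\<in>\<Sigma>. step A q a \<in> states A) \<and> accepting A \<subseteq> Pow (states A)}"

primrec run :: "'a dma \<Rightarrow> 'a word \<Rightarrow> nat word" where
  "run A \<alpha> 0 = initial A"
| "run A \<alpha> (Suc n) = step A (run A \<alpha> n) (\<alpha> n)"

definition accepts :: "'a dma \<Rightarrow> 'a word \<Rightarrow> bool" where
  "accepts A \<alpha> \<longleftrightarrow> limit (run A \<alpha>) \<in> accepting A"

text \<open>
  The code of an automaton, relative to a numbering \<open>num\<close> of the letters. The transition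
  function is given by its graph.
\<close>

definition dma_code :: "'a set \<Rightarrow> ('a \<Rightarrow> nat) \<Rightarrow> 'a dma \<Rightarrow> nat" where
  "dma_code \<Sigma> num A =
     prod_encode (set_encode (states A),
     prod_encode (initial A,
     prod_encode (set_encode ((\<lambda>(q, a). prod_encode (q, prod_encode (num a, step A q a)))
                                ` (states A \<times> \<Sigma>)),
                  set_encode (set_encode ` accepting A))))"

lemma dma_code_determines:
  assumes "finite \<Sigma>" "inj_on num \<Sigma>" "A \<in> dma_over \<Sigma>" "B \<in> dma_over \<Sigma>"
    and eq: "dma_code \<Sigma> num A = dma_code \<Sigma> num B"
  shows "states A = states B" "initial A = initial B" "accepting A = accepting B"
    "\<forall>q\<in>states A. \<forall>a\<in>\<Sigma>. step A q a = step B q a"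
proof -
  have fin: "finite (states A)" "finite (states B)"
    and sub: "accepting A \<subseteq> Pow (states A)" "accepting B \<subseteq> Pow (states B)"
    using assms by (auto simp: dma_over_def)
  have finF: "finite (accepting A)" "finite (accepting B)"
    using fin sub by (meson finite_Pow_iff finite_subset)+
  let ?g = "\<lambda>A. (\<lambda>(q, a). prod_encode (q, prod_encode (num a, step A q a))) ` (states A \<times> \<Sigma>)"
  note inj = inj_on_eq_iff[OF inj_on_set_encode]
  have *: "set_encode (states A) = set_encode (states B)" "initial A = initial B"
    "set_encode (?g A) = set_encode (?g B)"
    "set_encode (set_encode ` accepting A) = set_encode (set_encode ` accepting B)"
    using eq by (auto simp: dma_code_def prod_encode_eq)
  show st: "states A = states B" using *(1) fin by (simp add: inj)
  show "initial A = initial B" by (fact *(2))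
  have "set_encode ` accepting A = set_encode ` accepting B"
    using *(4) finF by (simp add: inj)
  moreover have "accepting A \<subseteq> Collect finite" "accepting B \<subseteq> Collect finite"
    using sub fin by (blast dest: finite_subset)+
  ultimately show "accepting A = accepting B"
    by (simp add: inj_on_image_eq_iff[OF inj_on_set_encode])
  have g: "?g A = ?g B" using *(3) fin assms(1) by (simp add: inj)
  show "\<forall>q\<in>states A. \<forall>a\<in>\<Sigma>. step A q a = step B q a"
  proof (intro ballI)
    fix q a assume qa: "q \<in> states A" "a \<in> \<Sigma>"
    then have "prod_encode (q, prod_encode (num a, step A q a)) \<in> ?g B"
      unfolding g[symmetric] by force
    then show "step A q a = step B q a"
      using qa assms(2) by (auto simp: prod_encode_eq inj_on_eq_iff)
  qed
qed

end

theory Submission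
  imports Defs
begin

text \<open>
  The set of states visited infinitely often by the run on a disjunctive word is a bottom strongly
  connected component: if every state of a closed set can reach a target, then a single word leads
  every state of that set through the target, and this word occurs infinitely often. The algorithm
  therefore runs the automaton until its state \<open>q\<close> is reachable from everything reachable from
  \<open>q\<close>, and looks up the set of states reachable from \<open>q\<close> in the acceptance table. As \<open>set_encode\<close>
  is monotone, unbounded search finds that set as the least code of a transition-closed set
  containing \<open>q\<close>.
\<close>

section \<open>Total recursive functions\<close>

text \<open>Only lists of length \<open>k\<close> are constrained, so a function may be written with
  \<open>xs ! i\<close> whatever it yields on other lists. Totality is built in; searches that may
  fail are handled with \<open>evaluates\<close> directly.\<close>

definition recursive :: "nat \<Rightarrow> (nat list \<Rightarrow> nat) \<Rightarrow> bool" where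
  "recursive k f \<longleftrightarrow> (\<exists>r. \<forall>xs. length xs = k \<longrightarrow> evaluates r xs (f xs))"

definition recursive_pred :: "nat \<Rightarrow> (nat list \<Rightarrow> bool) \<Rightarrow> bool" where
  "recursive_pred k P \<longleftrightarrow> recursive k (\<lambda>xs. of_bool (P xs))"

lemma recursive_cong:
  assumes "recursive k f" "\<And>xs. length xs = k \<Longrightarrow> f xs = g xs"
  shows "recursive k g"
  using assms unfolding recursive_def by metis

lemma recursive_pred_cong:
  assumes "recursive_pred k P" "\<And>xs. length xs = k \<Longrightarrow> P xs = Q xs"
  shows "recursive_pred k Q"
  using assms unfolding recursive_pred_def by (auto elim: recursive_cong)

lemma recursive_proj: "i < k \<Longrightarrow> recursive k (\<lambda>xs. xs ! i)"
  unfolding recursive_def by (metis evaluates.proj)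

lemma recursive_comp:
  assumes "recursive (length gs) f" "\<And>g. g \<in> set gs \<Longrightarrow> recursive k g"
  shows "recursive k (\<lambda>xs. f (map (\<lambda>g. g xs) gs))"
proof -
  obtain rf where rf: "\<And>xs. length xs = length gs \<Longrightarrow> evaluates rf xs (f xs)"
    using assms(1) unfolding recursive_def by blast
  obtain R where R: "\<And>g xs. g \<in> set gs \<Longrightarrow> length xs = k \<Longrightarrow> evaluates (R g) xs (g xs)"
    using assms(2) unfolding recursive_def by metis
  have "evaluates (Comp rf (map R gs)) xs (f (map (\<lambda>g. g xs) gs))" if "length xs = k" for xs
    by (rule evaluates.comp[where ys = "map (\<lambda>g. g xs) gs"]) (auto intro: rf R that)
  then show ?thesis unfolding recursive_def by blast
qed

text \<open>The premise is stated once in arity one; the conclusion then applies \<open>f\<close>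
  inside an expression of any arity. \<open>recursive_comp2\<close> does the same for binary
  functions.\<close>

lemma recursive_comp1:
  assumes "recursive (Suc 0) (\<lambda>xs. f (xs ! 0))" "recursive k g"
  shows "recursive k (\<lambda>xs. f (g xs))"
  using recursive_comp[of "[g]" "\<lambda>xs. f (xs ! 0)" k] assms by auto

lemma recursive_comp2:
  assumes "recursive 2 (\<lambda>xs. f (xs ! 0) (xs ! 1))" "recursive k g" "recursive k h"
  shows "recursive k (\<lambda>xs. f (g xs) (h xs))"
  using recursive_comp[of "[g, h]" "\<lambda>xs. f (xs ! 0) (xs ! 1)" k] assms
  by (auto simp: numeral_2_eq_2)

lemma recursive_pred_comp2:
  assumes "recursive_pred 2 (\<lambda>xs. P (xs ! 0) (xs ! 1))" "recursive k g" "recursive k h"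
  shows "recursive_pred k (\<lambda>xs. P (g xs) (h xs))"
  using recursive_comp2[of "\<lambda>x y. of_bool (P x y)"] assms unfolding recursive_pred_def by auto

lemma recursive_Suc:
  assumes "recursive k f"
  shows "recursive k (\<lambda>xs. Suc (f xs))"
proof (rule recursive_comp1[where f = Suc, OF _ assms])
  show "recursive (Suc 0) (\<lambda>xs. Suc (xs ! 0))"
    unfolding recursive_def
    by (rule exI[of _ Succ]) (auto simp: length_Suc_conv intro: evaluates.succ)
qed

lemma recursive_const: "recursive k (\<lambda>_. n)"
proof (induction n)
  case 0
  show ?case unfolding recursive_def using evaluates.zero by blast
qed (rule recursive_Suc)

text \<open>\<open>h\<close> enters through its recursion equations, so the rule applies to
  functions that HOL already has. Within \<open>g\<close>, position 0 holds the predecessor,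
  position 1 the value there, and the parameters start at position 2.\<close>

lemma recursive_primrec:
  assumes f: "recursive k f" and g: "recursive (Suc (Suc k)) g"
    and h0: "\<And>xs. length xs = k \<Longrightarrow> h (0 # xs) = f xs"
    and hS: "\<And>n xs. length xs = k \<Longrightarrow> h (Suc n # xs) = g (n # h (n # xs) # xs)"
  shows "recursive (Suc k) h"
proof -
  obtain rf where rf: "\<And>xs. length xs = k \<Longrightarrow> evaluates rf xs (f xs)"
    using f unfolding recursive_def by blast
  obtain rg where rg: "\<And>xs. length xs = Suc (Suc k) \<Longrightarrow> evaluates rg xs (g xs)"
    using g unfolding recursive_def by blast
  have "evaluates (PrimRec rf rg) (n # xs) (h (n # xs))" if "length xs = k" for n xs
  proof (induction n)
    case 0
    show ?case using that by (auto simp: h0 intro: evaluates.primrec_0 rf)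
  next
    case (Suc n)
    show ?case unfolding hS[OF that]
      by (rule evaluates.primrec_Suc[OF Suc rg]) (simp add: that)
  qed
  then show ?thesis
    unfolding recursive_def by (metis length_Suc_conv)
qed

section \<open>Arithmetic, logical connectives and bounded quantifiers\<close>

lemma recursive_add:
  assumes "recursive k f" "recursive k g"
  shows "recursive k (\<lambda>xs. f xs + g xs)"
proof (rule recursive_comp2[where f = "(+)", OF _ assms])
  have "recursive (Suc 1) (\<lambda>xs. xs ! 0 + xs ! 1)"
    by (rule recursive_primrec[where f = "\<lambda>xs. xs ! 0" and g = "\<lambda>xs. Suc (xs ! 1)"])
      (auto intro!: recursive_proj recursive_Suc)
  then show "recursive 2 (\<lambda>xs. xs ! 0 + xs ! 1)" by (simp add: numeral_2_eq_2)
qed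

lemma recursive_mult:
  assumes "recursive k f" "recursive k g"
  shows "recursive k (\<lambda>xs. f xs * g xs)"
proof (rule recursive_comp2[where f = "(*)", OF _ assms])
  have "recursive (Suc 1) (\<lambda>xs. xs ! 0 * xs ! 1)"
    by (rule recursive_primrec[where f = "\<lambda>xs. 0" and g = "\<lambda>xs. xs ! 1 + xs ! 2"])
      (auto intro!: recursive_proj recursive_const recursive_add)
  then show "recursive 2 (\<lambda>xs. xs ! 0 * xs ! 1)" by (simp add: numeral_2_eq_2)
qed

lemma recursive_diff:
  assumes "recursive k f" "recursive k g"
  shows "recursive k (\<lambda>xs. f xs - g xs)"
\<comment> \<open>The recursion iterates the predecessor as often as the subtrahend says. The
  recursion variable comes first, hence the swapped arguments.\<close>
proof (rule recursive_comp2[where f = "\<lambda>x y. y - x", OF _ assms(2,1)])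
  have pred: "recursive (Suc 0) (\<lambda>xs. xs ! 0 - Suc 0)"
    by (rule recursive_primrec[where f = "\<lambda>xs. 0" and g = "\<lambda>xs. xs ! 0"])
      (auto intro!: recursive_proj recursive_const)
  have "recursive (Suc 1) (\<lambda>xs. xs ! 1 - xs ! 0)"
    by (rule recursive_primrec[where f = "\<lambda>xs. xs ! 0" and g = "\<lambda>xs. xs ! 1 - Suc 0"])
      (auto intro!: recursive_proj recursive_comp1[where f = "\<lambda>x. x - Suc 0", OF pred])
  then show "recursive 2 (\<lambda>xs. xs ! 1 - xs ! 0)" by (simp add: numeral_2_eq_2)
qed

lemma recursive_pred_not:
  assumes "recursive_pred k P"
  shows "recursive_pred k (\<lambda>xs. \<not> P xs)"
  using recursive_diff[OF recursive_const[of k 1] assms[unfolded recursive_pred_def]]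
  unfolding recursive_pred_def by (rule recursive_cong) auto

lemma recursive_pred_conj:
  assumes "recursive_pred k P" "recursive_pred k Q"
  shows "recursive_pred k (\<lambda>xs. P xs \<and> Q xs)"
  using recursive_mult[OF assms[unfolded recursive_pred_def]]
  unfolding recursive_pred_def by (rule recursive_cong) auto

lemma recursive_pred_disj:
  assumes "recursive_pred k P" "recursive_pred k Q"
  shows "recursive_pred k (\<lambda>xs. P xs \<or> Q xs)"
  using recursive_pred_not[OF recursive_pred_conj[OF assms[THEN recursive_pred_not]]] by simp

lemma recursive_pred_imp:
  assumes "recursive_pred k P" "recursive_pred k Q"
  shows "recursive_pred k (\<lambda>xs. P xs \<longrightarrow> Q xs)"
  using recursive_pred_disj[OF assms(1)[THEN recursive_pred_not] assms(2)]
  by (rule recursive_pred_cong) auto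

text \<open>Truncated subtraction decides the order: \<open>1 - (f xs - g xs)\<close> is 1 exactly
  if \<open>f xs - g xs\<close> is 0.\<close>

lemma recursive_pred_le:
  assumes "recursive k f" "recursive k g"
  shows "recursive_pred k (\<lambda>xs. f xs \<le> g xs)"
  using recursive_diff[OF recursive_const[of k 1] recursive_diff[OF assms]]
  unfolding recursive_pred_def by (rule recursive_cong) auto

lemma recursive_pred_eq:
  assumes "recursive k f" "recursive k g"
  shows "recursive_pred k (\<lambda>xs. f xs = g xs)"
  using recursive_pred_conj[OF recursive_pred_le[OF assms] recursive_pred_le[OF assms(2,1)]]
  by (rule recursive_pred_cong) auto

lemma recursive_pred_ball:
  assumes P: "recursive_pred (Suc k) P" and B: "recursive k B"
  shows "recursive_pred k (\<lambda>xs. \<forall>t<B xs. P (t # xs))"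
proof -
  \<comment> \<open>The bound becomes the recursion variable, and the truth value is a product
    accumulated over all smaller \<open>t\<close>. The projections \<open>?ps m\<close> drop the
    first \<open>m\<close> arguments; \<open>m = 2\<close> skips the counter and the accumulated
    value, so that \<open>P\<close> sees the counter followed by the parameters.\<close>
  let ?h = "\<lambda>xs. of_bool (\<forall>t<hd xs. P (t # tl xs)) :: nat"
  let ?ps = "\<lambda>m. map (\<lambda>i xs. xs ! i) [m..<m + k]"
  have ps: "map (\<lambda>g. g zs) (?ps m) = drop m zs" if "length zs = m + k" for m and zs :: "nat list"
    using that by (intro nth_equalityI) auto
  have "recursive (Suc (Suc k)) (\<lambda>xs. of_bool (P (map (\<lambda>g. g xs) ((\<lambda>xs. xs ! 0) # ?ps 2))))"
    by (rule recursive_comp[where f = "\<lambda>xs. of_bool (P xs)"])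
      (use P in \<open>auto simp: recursive_pred_def simp del: upt_Suc intro!: recursive_proj\<close>)
  then have step: "recursive (Suc (Suc k)) (\<lambda>xs. of_bool (P (xs ! 0 # drop 2 xs)))"
    by (rule recursive_cong) (use ps[of _ 2] in \<open>simp del: map_map upt_Suc upt_conv_Cons\<close>)
  have "recursive (Suc k) ?h"
    by (rule recursive_primrec[where f = "\<lambda>xs. 1"
          and g = "\<lambda>xs. xs ! 1 * of_bool (P (xs ! 0 # drop 2 xs))"])
      (auto intro!: recursive_const recursive_mult recursive_proj step simp: less_Suc_eq)
  then have "recursive k (\<lambda>xs. ?h (map (\<lambda>g. g xs) (B # ?ps 0)))"
    by (intro recursive_comp) (auto intro!: recursive_proj B)
  then show ?thesis
    unfolding recursive_pred_def by (rule recursive_cong) (use ps[of _ 0] in simp)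
qed

lemma recursive_pred_bex:
  assumes "recursive_pred (Suc k) P" "recursive k B"
  shows "recursive_pred k (\<lambda>xs. \<exists>t<B xs. P (t # xs))"
  using recursive_pred_not[OF recursive_pred_ball[OF recursive_pred_not[OF assms(1)] assms(2)]]
  by simp

section \<open>Unbounded search\<close>

lemma evaluates_Mu_Least:
  assumes r: "\<And>n. evaluates r (n # xs) (of_bool (\<not> P n))" and "\<exists>n. P n"
  shows "evaluates (Mu r) xs (LEAST n. P n)"
proof (rule evaluates.mu)
  \<comment> \<open>\<open>Mu\<close> looks for a zero, and \<open>r\<close> computes the negation
    of \<open>P\<close>, so its first zero is the first hit.\<close>
  show "evaluates r ((LEAST n. P n) # xs) 0"
    using r[of "LEAST n. P n"] LeastI_ex[OF assms(2)] by simp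
  show "\<exists>y. evaluates r (m # xs) (Suc y)" if "m < (LEAST n. P n)" for m
    using r[of m] not_less_Least[OF that] by auto
qed

lemma recursive_Least:
  assumes P: "recursive_pred (Suc k) P" and ex: "\<And>xs. length xs = k \<Longrightarrow> \<exists>n. P (n # xs)"
  shows "recursive k (\<lambda>xs. LEAST n. P (n # xs))"
proof -
  obtain r where "\<And>xs. length xs = Suc k \<Longrightarrow> evaluates r xs (of_bool (\<not> P xs))"
    using recursive_pred_not[OF P] unfolding recursive_pred_def recursive_def by blast
  then have "evaluates (Mu r) xs (LEAST n. P (n # xs))" if "length xs = k" for xs
    using that ex by (intro evaluates_Mu_Least) auto
  then show ?thesis unfolding recursive_def by blast
qed

text \<open>A number that codes no automaton may make the main search run forever, so
  \<open>recursive_Least\<close> with its totality premise does not fit. Here one \<open>r\<close>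
  is fixed first, and its value is claimed only for those \<open>c\<close> where the search
  succeeds.\<close>

lemma evaluates_pred_Least:
  assumes G: "recursive_pred 2 (\<lambda>xs. G (xs ! 0) (xs ! 1))"
    and H: "recursive_pred 2 (\<lambda>xs. H (xs ! 0) (xs ! 1))"
  shows "\<exists>r. \<forall>c. (\<exists>n. G n c) \<longrightarrow> evaluates r [c] (of_bool (H (LEAST n. G n c) c))"
proof -
  obtain g where g: "\<And>xs. length xs = 2 \<Longrightarrow> evaluates g xs (of_bool (\<not> G (xs ! 0) (xs ! 1)))"
    using recursive_pred_not[OF G] unfolding recursive_pred_def recursive_def by blast
  obtain h where h: "\<And>xs. length xs = 2 \<Longrightarrow> evaluates h xs (of_bool (H (xs ! 0) (xs ! 1)))"
    using H unfolding recursive_pred_def recursive_def by blast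
  have "evaluates (Comp h [Mu g, Proj 0]) [c] (of_bool (H (LEAST n. G n c) c))"
    if ex: "\<exists>n. G n c" for c
  proof (rule evaluates.comp[where ys = "[LEAST n. G n c, c]"])
    show "evaluates h [LEAST n. G n c, c] (of_bool (H (LEAST n. G n c) c))"
      using h[of "[LEAST n. G n c, c]"] by simp
    have "evaluates (Mu g) [c] (LEAST n. G n c)"
      by (rule evaluates_Mu_Least[OF _ ex]) (use g[of "[_, c]"] in simp)
    moreover have "evaluates (Proj 0) [c] c"
      using evaluates.proj[of 0 "[c]"] by simp
    ultimately show "evaluates ([Mu g, Proj 0] ! i) [c] ([LEAST n. G n c, c] ! i)"
      if "i < length [Mu g, Proj 0]" for i
      using that by (auto simp: less_Suc_eq)
  qed simp
  then show ?thesis by blast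
qed

section \<open>Recursiveness of the codings of pairs and sets\<close>

lemma recursive_prod_encode:
  assumes "recursive k f" "recursive k g"
  shows "recursive k (\<lambda>xs. prod_encode (f xs, g xs))"
proof -
  have tri: "recursive (Suc 0) (\<lambda>xs. triangle (xs ! 0))"
    by (rule recursive_primrec[where f = "\<lambda>xs. 0" and g = "\<lambda>xs. xs ! 1 + Suc (xs ! 0)"])
      (auto intro!: recursive_const recursive_add recursive_Suc recursive_proj)
  show ?thesis
    unfolding prod_encode_def
    by (simp add: recursive_comp1[where f = triangle, OF tri] recursive_add assms)
qed

lemma recursive_fst_decode:
  assumes "recursive k f"
  shows "recursive k (\<lambda>xs. fst (prod_decode (f xs)))"
proof (rule recursive_comp1[OF _ assms])
  \<comment> \<open>Decoding is done by search: \<open>prod_encode\<close> is injective, so only the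
    true first component passes the test. The bound on \<open>b\<close> suffices because a component
    never exceeds the code of its pair.\<close>
  have eq: "(LEAST a. \<exists>b<Suc z. prod_encode (a, b) = z) = fst (prod_decode z)" for z
  proof (rule Least_equality)
    show "\<exists>b<Suc z. prod_encode (fst (prod_decode z), b) = z"
      by (rule exI[of _ "snd (prod_decode z)"])
        (metis le_imp_less_Suc le_prod_encode_2 prod.collapse prod_decode_inverse)
  qed auto
  have "recursive_pred (Suc (Suc (Suc 0))) (\<lambda>xs. prod_encode (xs ! 1, xs ! 0) = xs ! 2)"
    by (intro recursive_pred_eq recursive_prod_encode recursive_proj) auto
  from recursive_pred_bex[OF this, where B = "\<lambda>xs. Suc (xs ! 1)"]
  have "recursive_pred (Suc 1) (\<lambda>xs. \<exists>b<Suc (xs ! 1). prod_encode (xs ! 0, b) = xs ! 1)"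
    by (simp add: recursive_Suc recursive_proj)
  from recursive_Least[OF this]
  have "recursive (Suc 0) (\<lambda>xs. LEAST a. \<exists>b<Suc (xs ! 0). prod_encode (a, b) = xs ! 0)"
    by simp (metis le_imp_less_Suc le_prod_encode_2 prod.collapse prod_decode_inverse)
  then show "recursive (Suc 0) (\<lambda>xs. fst (prod_decode (xs ! 0)))" by (simp only: eq)
qed

lemma recursive_snd_decode:
  assumes "recursive k f"
  shows "recursive k (\<lambda>xs. snd (prod_decode (f xs)))"
proof (rule recursive_comp1[OF _ assms])
  have eq: "(LEAST b. prod_encode (fst (prod_decode z), b) = z) = snd (prod_decode z)" for z
    by (rule Least_equality) (auto, metis prod_encode_inverse snd_conv order_refl)
  have "recursive_pred (Suc 1) (\<lambda>xs. prod_encode (fst (prod_decode (xs ! 1)), xs ! 0) = xs ! 1)"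
    by (intro recursive_pred_eq recursive_prod_encode recursive_proj recursive_fst_decode) auto
  from recursive_Least[OF this]
  have "recursive (Suc 0) (\<lambda>xs. LEAST b. prod_encode (fst (prod_decode (xs ! 0)), b) = xs ! 0)"
    by simp (metis prod.collapse prod_decode_inverse)
  then show "recursive (Suc 0) (\<lambda>xs. snd (prod_decode (xs ! 0)))" by (simp only: eq)
qed

text \<open>Membership of \<open>x\<close> in the set coded by \<open>s\<close> is the binary digit
  of \<open>s\<close> at position \<open>x\<close>, obtained by halving \<open>s\<close>
  \<open>x\<close> times and taking the parity.\<close>

lemma recursive_pred_set_decode:
  assumes "recursive k f" "recursive k g"
  shows "recursive_pred k (\<lambda>xs. f xs \<in> set_decode (g xs))"
proof (rule recursive_pred_comp2[OF _ assms])
  have parity: "recursive (Suc 0) (\<lambda>xs. (xs ! 0) mod 2)"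
    by (rule recursive_primrec[where f = "\<lambda>xs. 0" and g = "\<lambda>xs. 1 - xs ! 1"])
      (auto intro!: recursive_const recursive_diff[OF recursive_const[of _ "Suc 0"]]
        recursive_proj simp: mod_Suc)
  have half: "recursive (Suc 0) (\<lambda>xs. (xs ! 0) div 2)"
    by (rule recursive_primrec[where f = "\<lambda>xs. 0" and g = "\<lambda>xs. xs ! 1 + (xs ! 0) mod 2"])
      (auto intro!: recursive_const recursive_add recursive_proj
        recursive_comp1[where f = "\<lambda>x. x mod 2", OF parity], presburger)
  have "recursive (Suc 1) (\<lambda>xs. (xs ! 1) div 2 ^ (xs ! 0))"
    by (rule recursive_primrec[where f = "\<lambda>xs. xs ! 0" and g = "\<lambda>xs. (xs ! 1) div 2"])
      (auto intro!: recursive_proj recursive_comp1[where f = "\<lambda>x. x div 2", OF half]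
        simp: div_mult2_eq[symmetric] mult.commute)
  then have "recursive 2 (\<lambda>xs. ((xs ! 1) div 2 ^ (xs ! 0)) mod 2)"
    by (intro recursive_comp1[where f = "\<lambda>x. x mod 2", OF parity]) (simp add: numeral_2_eq_2)
  then show "recursive_pred 2 (\<lambda>xs. xs ! 0 \<in> set_decode (xs ! 1))"
    unfolding recursive_pred_def
    by (rule recursive_cong) (auto simp: set_decode_def odd_iff_mod_2_eq_one)
qed

text \<open>An element \<open>x\<close> contributes \<open>2 ^ x\<close> to the code. Quantifiers
  over a coded set can therefore be bounded by the code itself.\<close>

lemma set_decode_less:
  assumes "x \<in> set_decode s"
  shows "x < s"
proof -
  have "s div 2 ^ x \<noteq> 0" using assms unfolding set_decode_def by (metis even_zero mem_Collect_eq)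
  then have "2 ^ x \<le> s" by (simp add: div_eq_0_iff)
  with less_exp[of x] show ?thesis by (rule less_le_trans)
qed

text \<open>The code is a sum of powers of two over the set, hence monotone under inclusion; this
  turns a least set into a least code.\<close>

lemma set_encode_le:
  assumes "A \<subseteq> set_decode s"
  shows "set_encode A \<le> s"
proof -
  have "set_encode A \<le> set_encode (set_decode s)"
    unfolding set_encode_def using assms by (intro sum_mono2) auto
  then show ?thesis by simp
qed

section \<open>The limit of the run\<close>

definition reachable :: "'a set \<Rightarrow> 'a dma \<Rightarrow> nat \<Rightarrow> nat set" where
  "reachable \<Sigma> A q = foldl (step A) q ` lists \<Sigma>"

text \<open>As reachability is reflexive, the equality lets every such \<open>p\<close> return to
  \<open>q\<close>: the state lies in a bottom strongly connected component. Equality of sets can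
  later be tested as equality of codes.\<close>

definition bottom :: "'a set \<Rightarrow> 'a dma \<Rightarrow> nat \<Rightarrow> bool" where
  "bottom \<Sigma> A q \<longleftrightarrow> (\<forall>p\<in>reachable \<Sigma> A q. reachable \<Sigma> A p = reachable \<Sigma> A q)"

lemma reachable_refl: "q \<in> reachable \<Sigma> A q"
  unfolding reachable_def by (rule image_eqI[of _ _ "[]"]) auto

lemma reachable_foldl:
  assumes "p \<in> reachable \<Sigma> A q" "u \<in> lists \<Sigma>"
  shows "foldl (step A) p u \<in> reachable \<Sigma> A q"
proof -
  obtain v where "v \<in> lists \<Sigma>" "p = foldl (step A) q v"
    using assms(1) unfolding reachable_def by blast
  then show ?thesis
    unfolding reachable_def using assms(2) by (intro image_eqI[of _ _ "v @ u"]) auto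
qed

lemma reachable_trans: "p \<in> reachable \<Sigma> A q \<Longrightarrow> reachable \<Sigma> A p \<subseteq> reachable \<Sigma> A q"
  using reachable_foldl unfolding reachable_def[of \<Sigma> A p] by blast

lemma reachable_step:
  assumes "p \<in> reachable \<Sigma> A q" "a \<in> \<Sigma>"
  shows "step A p a \<in> reachable \<Sigma> A q"
  using reachable_foldl[OF assms(1), of "[a]"] assms(2) by simp

lemma reachable_least:
  assumes "q \<in> S" "\<And>p a. p \<in> S \<Longrightarrow> a \<in> \<Sigma> \<Longrightarrow> step A p a \<in> S"
  shows "reachable \<Sigma> A q \<subseteq> S"
proof -
  have "foldl (step A) q u \<in> S" if "u \<in> lists \<Sigma>" for u
    using that by (induction u rule: rev_induct) (auto intro: assms)
  then show ?thesis unfolding reachable_def by blast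
qed

lemma reachable_subset_states:
  assumes "A \<in> dma_over \<Sigma>" "q \<in> states A"
  shows "reachable \<Sigma> A q \<subseteq> states A"
  using assms by (intro reachable_least) (auto simp: dma_over_def)

lemma run_in_states:
  assumes "A \<in> dma_over \<Sigma>" "range \<alpha> \<subseteq> \<Sigma>"
  shows "run A \<alpha> n \<in> states A"
  using assms by (induction n) (auto simp: dma_over_def)

lemma run_foldl: "run A \<alpha> (i + n) = foldl (step A) (run A \<alpha> i) (subsequence \<alpha> i (i + n))"
  by (induction n) (auto simp: subsequence_def)

text \<open>Take \<open>p\<close> with the fewest reachable states. Anything reachable from
  \<open>p\<close> reaches a subset of these, which by minimality has the same cardinality and so is
  the whole set.\<close>

lemma ex_bottom_reachable:
  assumes "finite (reachable \<Sigma> A q)"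
  shows "\<exists>p\<in>reachable \<Sigma> A q. bottom \<Sigma> A p"
proof -
  obtain p where p: "p \<in> reachable \<Sigma> A q"
    and min: "\<And>p'. p' \<in> reachable \<Sigma> A q \<Longrightarrow> card (reachable \<Sigma> A p) \<le> card (reachable \<Sigma> A p')"
    using exists_least_iff[of "\<lambda>n. \<exists>p\<in>reachable \<Sigma> A q. card (reachable \<Sigma> A p) = n"]
      reachable_refl[of q \<Sigma> A] by (metis linorder_not_le)
  have "reachable \<Sigma> A p' = reachable \<Sigma> A p" if "p' \<in> reachable \<Sigma> A p" for p'
    using reachable_trans[OF that] reachable_trans[OF p] that min assms
    by (metis card_seteq finite_subset subsetD)
  with p show ?thesis unfolding bottom_def by blast
qed

text \<open>
  One word serves all states of a finite closed set: append, for each state in turn, a word that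
  leads the state where it has got to so far into the target.
\<close>

lemma ex_word_visiting:
  assumes "finite X" "X \<subseteq> Y"
    and closed: "\<And>q a. q \<in> Y \<Longrightarrow> a \<in> \<Sigma> \<Longrightarrow> step A q a \<in> Y"
    and reach: "\<And>q. q \<in> Y \<Longrightarrow> \<exists>p\<in>reachable \<Sigma> A q. P p"
  shows "\<exists>w\<in>lists \<Sigma>. \<forall>q\<in>X. \<exists>n\<le>length w. P (foldl (step A) q (take n w))"
  using assms(1,2)
proof (induction X)
  case empty
  show ?case by auto
next
  case (insert q X)
  then obtain w where w: "w \<in> lists \<Sigma>"
    "\<And>q. q \<in> X \<Longrightarrow> \<exists>n\<le>length w. P (foldl (step A) q (take n w))"
    by auto
  \<comment> \<open>\<open>X\<close> grows while \<open>Y\<close> stays fixed: after reading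
    \<open>w\<close> from \<open>q\<close> the state need not be in \<open>X\<close>, but it is
    still in \<open>Y\<close>, where \<open>reach\<close> supplies \<open>v\<close>.\<close>
  have "foldl (step A) q w \<in> reachable \<Sigma> A q"
    using w(1) unfolding reachable_def by blast
  also have "\<dots> \<subseteq> Y"
    using insert.prems closed by (intro reachable_least) auto
  finally obtain v where v: "v \<in> lists \<Sigma>" "P (foldl (step A) (foldl (step A) q w) v)"
    using reach unfolding reachable_def by blast
  have "\<exists>n\<le>length (w @ v). P (foldl (step A) p (take n (w @ v)))" if "p \<in> insert q X" for p
  proof (cases "p = q")
    case True
    with v(2) show ?thesis by (intro exI[of _ "length (w @ v)"]) simp
  next
    case False
    with that w(2) obtain n where "n \<le> length w" "P (foldl (step A) p (take n w))" by blast
    then show ?thesis by (intro exI[of _ n]) simp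
  qed
  with w(1) v(1) show ?case by (intro bexI[of _ "w @ v"]) auto
qed

text \<open>Wherever in \<open>Y\<close> the run stands when an occurrence of the common word
  begins, it meets the target before that occurrence ends. Two targets are used: bottom states, with
  all states as \<open>Y\<close>, and a single state of a bottom component, with that component as
  \<open>Y\<close>.\<close>

lemma disjunctive_run_visits:
  assumes "disjunctive \<Sigma> \<alpha>" "finite Y"
    and closed: "\<And>q a. q \<in> Y \<Longrightarrow> a \<in> \<Sigma> \<Longrightarrow> step A q a \<in> Y"
    and reach: "\<And>q. q \<in> Y \<Longrightarrow> \<exists>p\<in>reachable \<Sigma> A q. P p"
    and run: "\<And>n. n \<ge> N \<Longrightarrow> run A \<alpha> n \<in> Y"
  shows "\<exists>\<^sub>\<infinity>n. P (run A \<alpha> n)"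
  unfolding INFM_nat_le
proof
  fix m
  obtain w where w: "w \<in> lists \<Sigma>"
    "\<And>q. q \<in> Y \<Longrightarrow> \<exists>n\<le>length w. P (foldl (step A) q (take n w))"
    using ex_word_visiting[OF assms(2) order_refl closed reach] by blast
  \<comment> \<open>Starting after \<open>N\<close> puts the run inside \<open>Y\<close>; starting
    after \<open>m\<close> makes the visit late enough.\<close>
  obtain i where i: "i \<ge> max N m" "subsequence \<alpha> i (i + length w) = w"
    using assms(1) w(1) unfolding disjunctive_def INFM_nat_le by blast
  obtain n where n: "n \<le> length w" "P (foldl (step A) (run A \<alpha> i) (take n w))"
    using w(2) run i(1) by (metis max.boundedE)
  have "take n w = subsequence \<alpha> i (i + n)"
    using n(1) by (subst i(2)[symmetric]) (auto simp: subsequence_def take_map)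
  with n(2) have "P (run A \<alpha> (i + n))" by (simp add: run_foldl)
  with i(1) show "\<exists>n\<ge>m. P (run A \<alpha> n)" by (intro exI[of _ "i + n"]) auto
qed

lemma ex_run_bottom:
  assumes "A \<in> dma_over \<Sigma>" "range \<alpha> \<subseteq> \<Sigma>" "disjunctive \<Sigma> \<alpha>"
  shows "\<exists>n. bottom \<Sigma> A (run A \<alpha> n)"
proof -
  have "\<exists>\<^sub>\<infinity>n. bottom \<Sigma> A (run A \<alpha> n)"
  proof (rule disjunctive_run_visits[OF assms(3), of "states A"])
    show "\<exists>p\<in>reachable \<Sigma> A q. bottom \<Sigma> A p" if "q \<in> states A" for q
      using reachable_subset_states[OF assms(1) that] assms(1)
      by (intro ex_bottom_reachable) (auto simp: dma_over_def intro: finite_subset)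
  qed (use assms run_in_states[OF assms(1,2)] in \<open>auto simp: dma_over_def\<close>)
  then show ?thesis by (rule INFM_E) blast
qed

text \<open>From time \<open>N\<close> on the run cannot leave \<open>?R\<close>. Conversely each
  state of \<open>?R\<close> reaches every \<open>p\<close> in \<open>?R\<close>, since the
  component is bottom, so disjunctiveness forces infinitely many visits to \<open>p\<close>.\<close>

lemma limit_run_eq_reachable:
  assumes "A \<in> dma_over \<Sigma>" "range \<alpha> \<subseteq> \<Sigma>" "disjunctive \<Sigma> \<alpha>"
    and bot: "bottom \<Sigma> A (run A \<alpha> N)"
  shows "limit (run A \<alpha>) = reachable \<Sigma> A (run A \<alpha> N)" (is "_ = ?R")
proof
  have run: "run A \<alpha> n \<in> ?R" if "n \<ge> N" for n
    using that
  proof (induction rule: dec_induct)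
    case (step n)
    with assms(2) show ?case by (auto intro: reachable_step)
  qed (rule reachable_refl)
  show "limit (run A \<alpha>) \<subseteq> ?R"
    unfolding limit_def INFM_nat_le using run by auto
  show "?R \<subseteq> limit (run A \<alpha>)"
  proof
    fix p assume p: "p \<in> ?R"
    have "\<exists>\<^sub>\<infinity>n. run A \<alpha> n = p"
    proof (rule disjunctive_run_visits[OF assms(3), of ?R])
      show "finite ?R"
        using reachable_subset_states[OF assms(1) run_in_states[OF assms(1,2)]] assms(1)
        by (auto simp: dma_over_def intro: finite_subset)
      show "\<exists>p'\<in>reachable \<Sigma> A q. p' = p" if "q \<in> ?R" for q
        using bot that p unfolding bottom_def by blast
    qed (auto intro: reachable_step run)
    then show "p \<in> limit (run A \<alpha>)" unfolding limit_def by simp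
  qed
qed

section \<open>The decision procedure\<close>

definition code_initial :: "nat \<Rightarrow> nat" where
  "code_initial c = fst (prod_decode (snd (prod_decode c)))"

definition code_graph :: "nat \<Rightarrow> nat" where
  "code_graph c = fst (prod_decode (snd (prod_decode (snd (prod_decode c)))))"

definition code_accepting :: "nat \<Rightarrow> nat" where
  "code_accepting c = snd (prod_decode (snd (prod_decode (snd (prod_decode c)))))"

text \<open>
  The alternative \<open>code_graph c \<le> q'\<close> makes the search total, also where \<open>c\<close> codes no automaton.
  It does not affect genuine successors, which are smaller than the code of the graph.
\<close>

definition code_step :: "nat \<Rightarrow> nat \<Rightarrow> nat \<Rightarrow> nat" where
  "code_step c q a = (LEAST q'. prod_encode (q, prod_encode (a, q')) \<in> set_decode (code_graph c)
     \<or> code_graph c \<le> q')"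

primrec code_run :: "(nat \<Rightarrow> nat) \<Rightarrow> nat \<Rightarrow> nat \<Rightarrow> nat" where
  "code_run a c 0 = code_initial c"
| "code_run a c (Suc n) = code_step c (code_run a c n) (a n)"

text \<open>An element \<open>t\<close> of the graph codes an edge; the formula reads off its source
  and target and skips the letter, as closure is under all letters. The bound on \<open>t\<close>
  loses nothing by \<open>set_decode_less\<close> and makes the quantifier bounded, as it does in
  \<open>code_bottom\<close>.\<close>

definition code_closed :: "nat \<Rightarrow> nat \<Rightarrow> bool" where
  "code_closed c s \<longleftrightarrow> (\<forall>t<code_graph c. t \<in> set_decode (code_graph c) \<longrightarrow>
     fst (prod_decode t) \<in> set_decode s \<longrightarrow>
     snd (prod_decode (snd (prod_decode t))) \<in> set_decode s)"

definition code_reachable :: "nat \<Rightarrow> nat \<Rightarrow> nat" where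
  "code_reachable c q = (LEAST s. code_closed c s \<and> q \<in> set_decode s)"

definition code_bottom :: "nat \<Rightarrow> nat \<Rightarrow> bool" where
  "code_bottom c q \<longleftrightarrow> (\<forall>p<code_reachable c q. p \<in> set_decode (code_reachable c q) \<longrightarrow>
     code_reachable c p = code_reachable c q)"

lemma prod_decode_snd_le: "snd (prod_decode t) \<le> t"
  by (metis le_prod_encode_2 prod.collapse prod_decode_inverse)

text \<open>Targets of edges are smaller than the code of the graph, so a long enough initial
  segment of the numbers is closed. This holds for every \<open>c\<close>, which makes the search in
  \<open>code_reachable\<close> total.\<close>

lemma ex_code_closed: "\<exists>s. code_closed c s \<and> q \<in> set_decode s"
proof (intro exI conjI)
  let ?s = "set_encode {..code_graph c + q}"
  show "q \<in> set_decode ?s" by simp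
  show "code_closed c ?s"
    unfolding code_closed_def
    using prod_decode_snd_le by (auto intro!: trans_le_add1) (meson less_imp_le order_trans)
qed

section \<open>Recursiveness of the operations on codes\<close>

lemmas recursive_intros =
  recursive_proj recursive_const recursive_Suc recursive_prod_encode
  recursive_fst_decode recursive_snd_decode
  recursive_pred_not recursive_pred_conj recursive_pred_disj recursive_pred_imp
  recursive_pred_le recursive_pred_eq recursive_pred_set_decode

lemma recursive_code_components:
  assumes "recursive k f"
  shows "recursive k (\<lambda>xs. code_initial (f xs))" "recursive k (\<lambda>xs. code_graph (f xs))"
    "recursive k (\<lambda>xs. code_accepting (f xs))"
  unfolding code_initial_def code_graph_def code_accepting_def
  by (intro recursive_intros assms)+

lemma recursive_code_step:
  assumes "recursive k f" "recursive k g" "recursive k h"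
  shows "recursive k (\<lambda>xs. code_step (f xs) (g xs) (h xs))"
proof -
  \<comment> \<open>The search variable \<open>q'\<close> takes position 0 and shifts the code, the
    state and the letter to positions 1, 2 and 3.\<close>
  have "recursive_pred (Suc 3) (\<lambda>xs.
      prod_encode (xs ! 2, prod_encode (xs ! 3, xs ! 0)) \<in> set_decode (code_graph (xs ! 1))
      \<or> code_graph (xs ! 1) \<le> xs ! 0)"
    by (intro recursive_intros recursive_code_components) auto
  from recursive_Least[OF this]
  have "recursive 3 (\<lambda>xs. code_step (xs ! 0) (xs ! 1) (xs ! 2))"
    unfolding code_step_def by simp blast
  then show ?thesis
    using recursive_comp[of "[f, g, h]" "\<lambda>xs. code_step (xs ! 0) (xs ! 1) (xs ! 2)" k] assms
    by (auto simp: numeral_3_eq_3 numeral_2_eq_2)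
qed

lemma recursive_code_run:
  assumes "recursive (Suc 0) (\<lambda>xs. a (xs ! 0))" "recursive k f" "recursive k g"
  shows "recursive k (\<lambda>xs. code_run a (f xs) (g xs))"
proof (rule recursive_comp2[where f = "\<lambda>n c. code_run a c n", OF _ assms(3,2)])
  have "recursive (Suc 1) (\<lambda>xs. code_run a (xs ! 1) (xs ! 0))"
    by (rule recursive_primrec[where f = "\<lambda>xs. code_initial (xs ! 0)"
          and g = "\<lambda>xs. code_step (xs ! 2) (xs ! 1) (a (xs ! 0))"])
      (auto intro!: recursive_code_components recursive_code_step recursive_proj
        recursive_comp1[where f = a, OF assms(1)])
  then show "recursive 2 (\<lambda>xs. code_run a (xs ! 1) (xs ! 0))" by (simp add: numeral_2_eq_2)
qed

lemma recursive_pred_code_closed: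
  assumes "recursive k f" "recursive k g"
  shows "recursive_pred k (\<lambda>xs. code_closed (f xs) (g xs))"
proof (rule recursive_pred_comp2[OF _ assms])
  have "recursive_pred (Suc 2) (\<lambda>xs. xs ! 0 \<in> set_decode (code_graph (xs ! 1)) \<longrightarrow>
      fst (prod_decode (xs ! 0)) \<in> set_decode (xs ! 2) \<longrightarrow>
      snd (prod_decode (snd (prod_decode (xs ! 0)))) \<in> set_decode (xs ! 2))"
    by (intro recursive_intros recursive_code_components) auto
  from recursive_pred_ball[OF this, where B = "\<lambda>xs. code_graph (xs ! 0)"]
  show "recursive_pred 2 (\<lambda>xs. code_closed (xs ! 0) (xs ! 1))"
    by (simp add: code_closed_def recursive_code_components recursive_proj)
qed

lemma recursive_code_reachable:
  assumes "recursive k f" "recursive k g"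
  shows "recursive k (\<lambda>xs. code_reachable (f xs) (g xs))"
proof (rule recursive_comp2[OF _ assms])
  have "recursive_pred (Suc 2) (\<lambda>xs. code_closed (xs ! 1) (xs ! 0) \<and> xs ! 2 \<in> set_decode (xs ! 0))"
    by (intro recursive_intros recursive_pred_code_closed) auto
  from recursive_Least[OF this]
  show "recursive 2 (\<lambda>xs. code_reachable (xs ! 0) (xs ! 1))"
    by (simp add: code_reachable_def ex_code_closed)
qed

lemma recursive_pred_code_bottom:
  assumes "recursive k f" "recursive k g"
  shows "recursive_pred k (\<lambda>xs. code_bottom (f xs) (g xs))"
proof (rule recursive_pred_comp2[OF _ assms])
  have "recursive_pred (Suc 2) (\<lambda>xs. xs ! 0 \<in> set_decode (code_reachable (xs ! 1) (xs ! 2)) \<longrightarrow>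
      code_reachable (xs ! 1) (xs ! 0) = code_reachable (xs ! 1) (xs ! 2))"
    by (intro recursive_intros recursive_code_reachable) auto
  from recursive_pred_ball[OF this, where B = "\<lambda>xs. code_reachable (xs ! 0) (xs ! 1)"]
  show "recursive_pred 2 (\<lambda>xs. code_bottom (xs ! 0) (xs ! 1))"
    by (simp add: code_bottom_def recursive_code_reachable recursive_proj)
qed

section \<open>Correctness of these operations on codes of automata\<close>

context
  fixes \<Sigma> :: "'a set" and num :: "'a \<Rightarrow> nat" and A :: "'a dma"
  assumes fin: "finite \<Sigma>" and inj: "inj_on num \<Sigma>" and A: "A \<in> dma_over \<Sigma>"
begin

lemma code_initial_dma_code: "code_initial (dma_code \<Sigma> num A) = initial A"
  by (simp add: code_initial_def dma_code_def)

lemma set_decode_code_graph: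
  "set_decode (code_graph (dma_code \<Sigma> num A)) =
    (\<lambda>(q, a). prod_encode (q, prod_encode (num a, step A q a))) ` (states A \<times> \<Sigma>)"
  using fin A by (simp add: code_graph_def dma_code_def dma_over_def)

text \<open>\<open>set_encode\<close> is injective on finite sets only; subsets of the finite state
  set are safe.\<close>

lemma set_encode_mem_code_accepting:
  assumes "S \<subseteq> states A"
  shows "set_encode S \<in> set_decode (code_accepting (dma_code \<Sigma> num A)) \<longleftrightarrow> S \<in> accepting A"
proof -
  have fin_sub: "finite S'" if "S' \<subseteq> states A" for S'
    using A that by (auto simp: dma_over_def intro: finite_subset)
  have sub: "accepting A \<subseteq> Pow (states A)" using A by (simp add: dma_over_def)
  then have "finite (accepting A)"
    using A by (auto simp: dma_over_def intro: finite_subset)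
  then have "set_decode (code_accepting (dma_code \<Sigma> num A)) = set_encode ` accepting A"
    by (simp add: code_accepting_def dma_code_def)
  then show ?thesis
    using fin_sub assms sub by (auto simp: inj_on_eq_iff[OF inj_on_set_encode] subset_iff)
qed

lemma code_step_dma_code:
  assumes "q \<in> states A" "a \<in> \<Sigma>"
  shows "code_step (dma_code \<Sigma> num A) q (num a) = step A q a"
  unfolding code_step_def
proof (rule Least_equality)
  let ?T = "code_graph (dma_code \<Sigma> num A)"
  \<comment> \<open>Injectivity of \<open>num\<close> recovers the letter from its number, so the
    graph holds exactly one target for \<open>q\<close> and \<open>a\<close>.\<close>
  have mem: "prod_encode (q, prod_encode (num a, q')) \<in> set_decode ?T \<longleftrightarrow> q' = step A q a" for q'
    using assms inj unfolding set_decode_code_graph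
    by (auto simp: prod_encode_eq inj_on_eq_iff image_iff)
  then show "prod_encode (q, prod_encode (num a, step A q a)) \<in> set_decode ?T \<or> ?T \<le> step A q a"
    by simp
  have "step A q a \<le> prod_encode (q, prod_encode (num a, step A q a))"
    by (meson le_prod_encode_2 order_trans)
  also have "\<dots> < ?T" by (rule set_decode_less) (simp add: mem)
  finally show "step A q a \<le> q'"
    if "prod_encode (q, prod_encode (num a, q')) \<in> set_decode ?T \<or> ?T \<le> q'" for q'
    using that mem by auto
qed

lemma code_run_dma_code:
  assumes "range \<alpha> \<subseteq> \<Sigma>"
  shows "code_run (\<lambda>n. num (\<alpha> n)) (dma_code \<Sigma> num A) n = run A \<alpha> n"
  using assms run_in_states[OF A assms]
  by (induction n) (auto simp: code_initial_dma_code intro!: code_step_dma_code)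

text \<open>The set coded by \<open>s\<close> may contain numbers that are not states. The graph has
  no edges leaving them, hence the intersection.\<close>

lemma code_closed_dma_code:
  "code_closed (dma_code \<Sigma> num A) s \<longleftrightarrow>
    (\<forall>q\<in>states A \<inter> set_decode s. \<forall>a\<in>\<Sigma>. step A q a \<in> set_decode s)"
proof -
  have "code_closed (dma_code \<Sigma> num A) s \<longleftrightarrow>
    (\<forall>t\<in>set_decode (code_graph (dma_code \<Sigma> num A)). fst (prod_decode t) \<in> set_decode s \<longrightarrow>
      snd (prod_decode (snd (prod_decode t))) \<in> set_decode s)"
    unfolding code_closed_def using set_decode_less by blast
  then show ?thesis unfolding set_decode_code_graph by auto
qed

lemma code_reachable_dma_code:
  assumes "q \<in> states A"
  shows "code_reachable (dma_code \<Sigma> num A) q = set_encode (reachable \<Sigma> A q)"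
  unfolding code_reachable_def
proof (rule Least_equality)
  have "finite (reachable \<Sigma> A q)"
    using reachable_subset_states[OF A assms] A by (auto simp: dma_over_def intro: finite_subset)
  then show "code_closed (dma_code \<Sigma> num A) (set_encode (reachable \<Sigma> A q)) \<and>
      q \<in> set_decode (set_encode (reachable \<Sigma> A q))"
    by (auto simp: code_closed_dma_code reachable_refl reachable_step)
next
  fix s assume s: "code_closed (dma_code \<Sigma> num A) s \<and> q \<in> set_decode s"
  \<comment> \<open>Cutting down to \<open>states A\<close> gives a set closed under
    \<open>step A\<close>, to which \<open>reachable_least\<close> applies.\<close>
  have "reachable \<Sigma> A q \<subseteq> states A \<inter> set_decode s"
    using s assms A by (intro reachable_least) (auto simp: code_closed_dma_code dma_over_def)
  then show "set_encode (reachable \<Sigma> A q) \<le> s" by (intro set_encode_le) auto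
qed

lemma code_bottom_dma_code:
  assumes "q \<in> states A"
  shows "code_bottom (dma_code \<Sigma> num A) q \<longleftrightarrow> bottom \<Sigma> A q"
proof -
  have sub: "reachable \<Sigma> A p \<subseteq> states A" if "p \<in> states A" for p
    using reachable_subset_states[OF A that] .
  have fin_reach: "finite (reachable \<Sigma> A p)" if "p \<in> states A" for p
    using sub[OF that] A by (auto simp: dma_over_def intro: finite_subset)
  have "code_bottom (dma_code \<Sigma> num A) q \<longleftrightarrow>
    (\<forall>p\<in>reachable \<Sigma> A q. set_encode (reachable \<Sigma> A p) = set_encode (reachable \<Sigma> A q))"
    using fin_reach[OF assms] sub[OF assms] set_decode_less[of _ "set_encode (reachable \<Sigma> A q)"]
    by (auto simp: code_bottom_def code_reachable_dma_code assms subset_iff)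
  \<comment> \<open>Reachable sets are finite, so comparing their codes is comparing the
    sets.\<close>
  also have "\<dots> \<longleftrightarrow> bottom \<Sigma> A q"
    unfolding bottom_def using fin_reach sub[OF assms] assms
    by (intro ball_cong refl) (auto simp: inj_on_eq_iff[OF inj_on_set_encode] subset_iff)
  finally show ?thesis .
qed

end

theorem theorem3p5:
  fixes \<Sigma> :: "'a set" and num :: "'a \<Rightarrow> nat" and \<alpha> :: "'a word"
  assumes "finite \<Sigma>" and "inj_on num \<Sigma>"
    and "range \<alpha> \<subseteq> \<Sigma>"
    and "disjunctive \<Sigma> \<alpha>"
    and "computable (\<lambda>n. num (\<alpha> n))"
  shows "decidable_on (dma_over \<Sigma>) (dma_code \<Sigma> num) (\<lambda>A. accepts A \<alpha>)"
proof -
  define run_code where "run_code c n = code_run (\<lambda>n. num (\<alpha> n)) c n" for c n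
  \<comment> \<open>\<open>G\<close> is the stopping test of the search over time, \<open>H\<close>
    the table lookup made at the time found.\<close>
  define G where "G n c \<longleftrightarrow> code_bottom c (run_code c n)" for n c
  define H where "H n c \<longleftrightarrow> code_reachable c (run_code c n) \<in> set_decode (code_accepting c)" for n c
  have "recursive (Suc 0) (\<lambda>xs. num (\<alpha> (xs ! 0)))"
    using assms(5) unfolding computable_def recursive_def
    by (metis length_0_conv length_Suc_conv nth_Cons_0)
  note recursive_run = recursive_code_run[OF this]
  have "recursive_pred 2 (\<lambda>xs. G (xs ! 0) (xs ! 1))"
    unfolding G_def run_code_def
    by (intro recursive_pred_code_bottom recursive_run recursive_proj) auto
  moreover have "recursive_pred 2 (\<lambda>xs. H (xs ! 0) (xs ! 1))"
    unfolding H_def run_code_def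
    by (intro recursive_pred_set_decode recursive_code_reachable recursive_code_components
        recursive_run recursive_proj) auto
  \<comment> \<open>\<open>r\<close> is fixed before any automaton is considered, so a single
    algorithm serves them all.\<close>
  ultimately obtain r where
    r: "\<And>c. \<exists>n. G n c \<Longrightarrow> evaluates r [c] (of_bool (H (LEAST n. G n c) c))"
    using evaluates_pred_Least by blast
  have "evaluates r [dma_code \<Sigma> num A] (if accepts A \<alpha> then 1 else 0)"
    if A: "A \<in> dma_over \<Sigma>" for A
  proof -
    let ?c = "dma_code \<Sigma> num A"
    let ?n = "LEAST n. G n ?c"
    note run = run_in_states[OF A assms(3)]
    have G: "G n ?c \<longleftrightarrow> bottom \<Sigma> A (run A \<alpha> n)" for n
      using assms A run by (simp add: G_def run_code_def code_run_dma_code code_bottom_dma_code)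
    \<comment> \<open>Disjunctiveness guarantees here that the search halts on the code of every
      automaton.\<close>
    then have ex: "\<exists>n. G n ?c" using ex_run_bottom A assms by blast
    have "bottom \<Sigma> A (run A \<alpha> ?n)" using LeastI_ex[OF ex] by (simp only: G)
    then have lim: "limit (run A \<alpha>) = reachable \<Sigma> A (run A \<alpha> ?n)"
      by (rule limit_run_eq_reachable[OF A assms(3,4)])
    have "H ?n ?c \<longleftrightarrow> accepts A \<alpha>"
      using assms A run reachable_subset_states[OF A run]
      by (simp add: H_def run_code_def code_run_dma_code code_reachable_dma_code
          set_encode_mem_code_accepting accepts_def lim)
    with r[OF ex] show ?thesis by (simp add: of_bool_def)
  qed
  then show ?thesis unfolding decidable_on_def by blast
qed

end
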